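(* For every $k\geq3$, $$G_{21\mbox{-}3\mbox{-}\cdots\mbox{-}k}(x)=\frac{1}{U_k^2\left(\frac{1}{2\sqrt{x}}\right)}.$$
   Context: A generalized pattern is a permutation of $\{1,\dots,k\}$ written as a word $\tau_1\cdots\tau_k$ in which each pair of adjacent letters may or may not be separated by a dash "-". An occurrence of $\tau$ in $\pi=\pi_1\cdots\pi_n\in S_n$ is a choice of indices $i_1<\dots<i_k$ with $(\pi_{i_1},\dots,\pi_{i_k})$ order-isomorphic to $(\tau_1,\dots,\tau_k)$ and $i_{j+1}=i_j+1$ whenever $\tau_j,\tau_{j+1}$ are not separated by a dash; $\pi$ avoids $\tau$ if there is no occurrence. $1\mbox{-}3\mbox{-}2$ is the classical pattern $132$. $G_\tau(x)=\sum_{n\geq0}g_\tau(n)x^n$ with $g_\tau(n)$ the number of permutations in $S_n$ avoiding $1\mbox{-}3\mbox{-}2$ and having exactly one occurrence of $\tau$. $U_p$ is the Chebyshev polynomial of the second kind, $U_p(\cos\theta)=\sin((p+1)\theta)/\sin\theta$. *)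

theory Defs
  imports
    "HOL-Analysis.Analysis"
    "HOL-Computational_Algebra.Computational_Algebra"
    "HOL-Combinatorics.Multiset_Permutations"
begin

text \<open>
  Positions are counted from 0: \<open>j \<in> dashes \<tau>\<close> means that the letters \<open>letters \<tau> ! j\<close> and
  \<open>letters \<tau> ! (j + 1)\<close> are separated by a dash.
\<close>

datatype gpattern = GPattern (letters: "nat list") (dashes: "nat set")

definition order_isomorphic :: "nat list \<Rightarrow> nat list \<Rightarrow> bool" where
  "order_isomorphic xs ys \<longleftrightarrow> length xs = length ys \<and>
     (\<forall>a < length xs. \<forall>b < length xs. xs ! a < xs ! b \<longleftrightarrow> ys ! a < ys ! b)"

definition occurrences :: "gpattern \<Rightarrow> nat list \<Rightarrow> nat list set" where
  "occurrences \<tau> \<pi> = {is. length is = length (letters \<tau>) \<and> sorted_wrt (<) is \<and>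
     set is \<subseteq> {..<length \<pi>} \<and>
     order_isomorphic (map (\<lambda>i. \<pi> ! i) is) (letters \<tau>) \<and>
     (\<forall>j. Suc j < length (letters \<tau>) \<and> j \<notin> dashes \<tau> \<longrightarrow> is ! Suc j = is ! j + 1)}"

definition avoids :: "nat list \<Rightarrow> gpattern \<Rightarrow> bool" where
  "avoids \<pi> \<tau> \<longleftrightarrow> occurrences \<tau> \<pi> = {}"

definition pattern_1_3_2 :: gpattern where
  "pattern_1_3_2 = GPattern [1, 3, 2] {0, 1}"

text \<open>The pattern \<open>21-3-\<dots>-k\<close>, for \<open>k \<ge> 2\<close>.\<close>

definition pattern_21_3_to :: "nat \<Rightarrow> gpattern" where
  "pattern_21_3_to k = GPattern (2 # 1 # [3..<Suc k]) {1..<k - 1}"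

text \<open>Elements of \<open>S\<^sub>n\<close> are words in one-line notation.\<close>

definition g_count :: "gpattern \<Rightarrow> nat \<Rightarrow> nat" where
  "g_count \<tau> n = card {\<pi> \<in> permutations_of_set {1..n}.
     avoids \<pi> pattern_1_3_2 \<and> card (occurrences \<tau> \<pi>) = 1}"

definition G_series :: "gpattern \<Rightarrow> real fps" where
  "G_series \<tau> = Abs_fps (\<lambda>n. of_nat (g_count \<tau> n))"

definition Chebyshev_U :: "nat \<Rightarrow> real poly" where
  "Chebyshev_U p = (THE P. \<forall>\<theta>. sin \<theta> \<noteq> 0 \<longrightarrow>
     poly P (cos \<theta>) = sin ((real p + 1) * \<theta>) / sin \<theta>)"

lemma Chebyshev_U_exists:
  "\<exists>P :: real poly. \<forall>\<theta>. poly P (cos \<theta>) * sin \<theta> = sin ((real p + 1) * \<theta>)"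
proof (induction p rule: less_induct)
  case (less p)
  consider "p = 0" | "p = 1" | q where "p = Suc (Suc q)"
    by (metis One_nat_def not0_implies_Suc)
  then show ?case
  proof cases
    case 1
    then show ?thesis by (intro exI[of _ 1]) simp
  next
    case 2
    then show ?thesis by (intro exI[of _ "[:0, 2:]"]) (simp add: sin_double)
  next
    case 3
    obtain P where P: "\<And>\<theta>. poly P (cos \<theta>) * sin \<theta> = sin ((real (Suc q) + 1) * \<theta>)"
      using less[of "Suc q"] 3 by auto
    obtain Q where Q: "\<And>\<theta>. poly Q (cos \<theta>) * sin \<theta> = sin ((real q + 1) * \<theta>)"
      using less[of q] 3 by auto
    have "poly ([:0, 2:] * P - Q) (cos \<theta>) * sin \<theta> = sin ((real p + 1) * \<theta>)" for \<theta>
    proof -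
      define a where "a = (real (Suc q) + 1) * \<theta>"
      have e: "(real p + 1) * \<theta> = a + \<theta>" "(real q + 1) * \<theta> = a - \<theta>"
        using 3 by (simp_all add: a_def algebra_simps)
      have "poly ([:0, 2:] * P - Q) (cos \<theta>) * sin \<theta> =
          2 * cos \<theta> * (poly P (cos \<theta>) * sin \<theta>) - poly Q (cos \<theta>) * sin \<theta>"
        by (simp add: algebra_simps)
      also have "\<dots> = 2 * cos \<theta> * sin a - sin (a - \<theta>)"
        unfolding P Q e a_def ..
      also have "\<dots> = sin (a + \<theta>)"
        by (simp add: sin_add sin_diff)
      finally show ?thesis using e by simp
    qed
    then show ?thesis by blast
  qed
qed

lemma Chebyshev_U_unique:
  "\<exists>!P :: real poly. \<forall>\<theta>. sin \<theta> \<noteq> 0 \<longrightarrow>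
     poly P (cos \<theta>) = sin ((real p + 1) * \<theta>) / sin \<theta>"
proof (rule ex_ex1I)
  show "\<exists>P :: real poly. \<forall>\<theta>. sin \<theta> \<noteq> 0 \<longrightarrow>
     poly P (cos \<theta>) = sin ((real p + 1) * \<theta>) / sin \<theta>"
    using Chebyshev_U_exists[of p] by (metis nonzero_mult_div_cancel_right)
next
  fix P Q :: "real poly"
  assume P: "\<forall>\<theta>. sin \<theta> \<noteq> 0 \<longrightarrow> poly P (cos \<theta>) = sin ((real p + 1) * \<theta>) / sin \<theta>"
    and Q: "\<forall>\<theta>. sin \<theta> \<noteq> 0 \<longrightarrow> poly Q (cos \<theta>) = sin ((real p + 1) * \<theta>) / sin \<theta>"
  have "poly (P - Q) x = 0" if "x \<in> {-1<..<1}" for x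
  proof -
    have "sin (arccos x) \<noteq> 0" using that by (intro sin_arccos_nonzero) auto
    with P Q have "poly P (cos (arccos x)) = poly Q (cos (arccos x))" by simp
    then show ?thesis using that by simp
  qed
  then have "{-1<..<1} \<subseteq> {x. poly (P - Q) x = 0}" by blast
  moreover have "infinite {-1<..<1::real}" by simp
  ultimately have "infinite {x. poly (P - Q) x = 0}" using finite_subset by blast
  then have "P - Q = 0" using poly_roots_finite by blast
  then show "P = Q" by simp
qed

lemma Chebyshev_U_cos:
  "sin \<theta> \<noteq> 0 \<Longrightarrow> poly (Chebyshev_U p) (cos \<theta>) = sin ((real p + 1) * \<theta>) / sin \<theta>"
  using theI'[OF Chebyshev_U_unique[of p]] unfolding Chebyshev_U_def by blast

text \<open>
  \<open>U\<^sub>p(1 / (2t))\<close> as a formal Laurent series in \<open>t\<close>. The indeterminate \<open>t\<close> plays the role of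
  \<open>\<surd>x\<close>, so that a power series \<open>G(x)\<close> becomes \<open>G(t\<^sup>2)\<close>.
\<close>

definition Chebyshev_U_half_inv :: "nat \<Rightarrow> real fls" where
  "Chebyshev_U_half_inv p = poly (map_poly fls_const (Chebyshev_U p)) (1 / (2 * fls_X))"

end

theory Submission
  imports Defs
begin

text \<open>
  A nonempty 132-avoiding permutation is \<open>L n R\<close> with \<open>n\<close> maximal, every letter of \<open>L\<close> above
  every letter of \<open>R\<close>, and \<open>L\<close>, \<open>R\<close> 132-avoiding. For \<open>k \<ge> 3\<close> an occurrence of \<open>21-3-\<dots>-k\<close> lies
  in \<open>L\<close>, lies in \<open>R\<close>, or is an occurrence of \<open>21-3-\<dots>-(k-1)\<close> in \<open>L\<close> extended by \<open>n\<close>. Hence the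
  generating functions \<open>A\<^sub>k\<close> (no occurrence) and \<open>G\<^sub>k\<close> (one occurrence) satisfy
  \<open>A\<^sub>k = 1 + x A\<^sub>k\<^sub>-\<^sub>1 A\<^sub>k\<close> and \<open>G\<^sub>k = x A\<^sub>k\<^sub>-\<^sub>1 G\<^sub>k + x H\<^sub>k\<^sub>-\<^sub>1 A\<^sub>k\<close>, where \<open>H\<^sub>k\<close> counts the permutations
  with one occurrence of \<open>21-3-\<dots>-k\<close> and none of \<open>21-3-\<dots>-(k+1)\<close>. For \<open>k \<ge> 3\<close> the second
  condition is automatic, as an occurrence of the longer pattern contains two of the shorter one, so
  \<open>H\<^sub>k = G\<^sub>k\<close>; for \<open>k = 2\<close> it is not. With \<open>x = t\<^sup>2\<close> and \<open>U\<^sub>p\<close> evaluated at \<open>1/(2t)\<close>, the Chebyshev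
  recurrence gives \<open>t A\<^sub>k U\<^sub>k = U\<^sub>k\<^sub>-\<^sub>1\<close>; since \<open>G\<^sub>k = x H\<^sub>k\<^sub>-\<^sub>1 A\<^sub>k\<^sup>2\<close>, the product \<open>H\<^sub>k U\<^sub>k\<^sup>2\<close> does not
  depend on \<open>k\<close>, and it is 1 for \<open>k = 2\<close>.
\<close>

section \<open>Counting by recursion on words\<close>

fun no132 :: "nat list \<Rightarrow> bool" where
  "no132 [] \<longleftrightarrow> True"
| "no132 (x # w) \<longleftrightarrow> sorted (filter (\<lambda>y. x < y) w) \<and> no132 w"

text \<open>The number of ways to continue \<open>x\<close> by \<open>j\<close> later letters to a
  strictly increasing sequence: the letters after 21 in the pattern when \<open>x\<close> plays the
  2.\<close>

fun inc_count :: "nat \<Rightarrow> nat \<Rightarrow> nat list \<Rightarrow> nat" where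
  "inc_count 0 x w = 1"
| "inc_count (Suc j) x [] = 0"
| "inc_count (Suc j) x (y # w) = inc_count (Suc j) x w + (if x < y then inc_count j y w else 0)"

text \<open>The index \<open>j\<close> stands for the pattern \<open>21-3-\<dots>-k\<close> with \<open>k = j + 2\<close>.\<close>

fun occ_count :: "nat \<Rightarrow> nat list \<Rightarrow> nat" where
  "occ_count j (x # y # w) = (if y < x then inc_count j x w else 0) + occ_count j (y # w)"
| "occ_count j w = 0"

text \<open>The word \<open>L n R\<close> rebuilt from standardized parts. Lifting \<open>u\<close>
  above \<open>v\<close> is forced, since a letter of \<open>L\<close> below one of \<open>R\<close>
  would form 1-3-2 with the maximum.\<close>

definition join :: "nat list \<Rightarrow> nat list \<Rightarrow> nat list" where
  "join u v = map (\<lambda>x. x + length v) u @ Suc (length u + length v) # v"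

section \<open>Effect of shifts and of a maximal letter\<close>

lemma inc_count_map_add: "inc_count j (x + b) (map (\<lambda>x. x + b) w) = inc_count j x w"
  by (induction j x w rule: inc_count.induct) auto

lemma occ_count_map_add: "occ_count j (map (\<lambda>x. x + b) w) = occ_count j w"
  by (induction j w rule: occ_count.induct) (auto simp: inc_count_map_add)

lemma no132_map_add: "no132 (map (\<lambda>x. x + b) w) = no132 w"
  by (induction w) (auto simp: filter_map o_def sorted_map)

lemma inc_count_eq_0: "\<forall>y\<in>set w. y \<le> x \<Longrightarrow> inc_count (Suc j) x w = 0"
  by (induction w) auto

text \<open>A continuation of \<open>x\<close> cannot use \<open>v\<close>, and \<open>m\<close> can
  only be its last letter; the second summand counts those that end in \<open>m\<close>.\<close>

lemma inc_count_append_max: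
  assumes "\<forall>y\<in>set u. y < m" "x < m" "\<forall>y\<in>set v. y \<le> x"
  shows "inc_count (Suc j) x (u @ m # v) = inc_count (Suc j) x u + inc_count j x u"
  using assms
proof (induction u arbitrary: x j)
  case Nil
  then have "inc_count j m v = inc_count j x []"
    by (cases j) (auto intro!: inc_count_eq_0)
  with Nil show ?case by (auto intro!: inc_count_eq_0)
next
  case (Cons y u)
  \<comment> \<open>The induction hypothesis covers positive indices only; for \<open>j = 0\<close>
    both sides are 1, hence the 0 branch of the \<open>case\<close>.\<close>
  have "inc_count j y (u @ m # v) = inc_count j y u + (case j of 0 \<Rightarrow> 0 | Suc i \<Rightarrow> inc_count i y u)"
    if "x < y"
  proof (cases j)
    case (Suc i)
    with Cons.IH[of y i] Cons.prems that show ?thesis by fastforce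
  qed simp
  with Cons show ?case by (cases j) auto
qed

text \<open>Index 0 counts descents: the step up to \<open>m\<close> is none, the step down from
  \<open>m\<close> is one.\<close>

lemma occ_count_0_append_max:
  assumes "\<forall>y\<in>set u. y < m" "\<forall>y\<in>set v. y < m"
  shows "occ_count 0 (u @ m # v) = occ_count 0 u + occ_count 0 v + (if v = [] then 0 else 1)"
  using assms
proof (induction "0 :: nat" u rule: occ_count.induct)
  case "2_1"
  then show ?case by (cases v) auto
next
  case ("2_2" y)
  then show ?case by (cases v) auto
qed auto

text \<open>The middle summand comes from occurrences of the shorter pattern in \<open>u\<close>
  completed by \<open>m\<close>. Nothing exceeds \<open>m\<close>, so \<open>m\<close> is never the
  2, and an occurrence with its 2 in \<open>u\<close> cannot continue into \<open>v\<close>, whose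
  letters are too small.\<close>

lemma occ_count_Suc_append_max:
  assumes "\<forall>y\<in>set u. y < m" "\<forall>y\<in>set v. y < m" "\<forall>x\<in>set u. \<forall>y\<in>set v. y \<le> x"
  shows "occ_count (Suc j) (u @ m # v)
    = occ_count (Suc j) u + occ_count j u + occ_count (Suc j) v"
  using assms
proof (induction "Suc j" u rule: occ_count.induct)
  case (1 x y w)
  then show ?case using inc_count_append_max[of w m x v j] by auto
next
  case "2_1"
  then show ?case by (cases v) (auto intro!: inc_count_eq_0)
next
  case ("2_2" y)
  then show ?case by (cases v) (auto intro!: inc_count_eq_0)
qed

lemma no132_append_max:
  assumes "\<forall>y\<in>set u. y < m" "\<forall>y\<in>set v. y < m" "\<forall>x\<in>set u. \<forall>y\<in>set v. y \<le> x"
  shows "no132 (u @ m # v) \<longleftrightarrow> no132 u \<and> no132 v"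
  using assms
proof (induction u)
  case Nil
  then have "filter (\<lambda>y. m < y) v = []" by (auto simp: filter_empty_conv)
  then show ?case by simp
next
  case (Cons x u)
  then have "filter (\<lambda>y. x < y) v = []" by (auto simp: filter_empty_conv)
  with Cons show ?case by (auto simp: sorted_append less_imp_le)
qed

lemma no132_append_max_le:
  assumes "no132 (u @ m # v)" "x \<in> set u" "y \<in> set v" "x < m" "y < m"
  shows "y \<le> x"
  using assms
proof (induction u)
  case (Cons a u)
  then show ?case by (cases "x = a") (auto simp: sorted_append not_le[symmetric])
qed simp

section \<open>Longer patterns contain shorter ones\<close>

lemma inc_count_Suc_eq_0: "inc_count j x w = 0 \<Longrightarrow> inc_count (Suc j) x w = 0"
  by (induction j x w rule: inc_count.induct) (auto split: if_splits)

lemma inc_count_mono: "x \<le> y \<Longrightarrow> inc_count j y w \<le> inc_count j x w"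
proof (induction w arbitrary: j)
  case Nil
  then show ?case by (cases j) auto
next
  case (Cons a w)
  then show ?case by (cases j) (auto intro: add_mono le_trans trans_le_add1)
qed

lemma inc_count_Suc_eq_0_if_1:
  "inc_count (Suc j) x w = 1 \<Longrightarrow> inc_count (Suc (Suc j)) x w = 0"
proof (induction w)
  case (Cons y w)
  show ?case
  proof (cases "x < y \<and> inc_count j y w \<noteq> 0")
    case True
    with Cons.prems have 0: "inc_count (Suc j) x w = 0" by auto
    moreover have "inc_count (Suc j) y w \<le> inc_count (Suc j) x w"
      using True by (intro inc_count_mono) auto
    ultimately show ?thesis using inc_count_Suc_eq_0[OF 0] by simp
  next
    case False
    with Cons show ?thesis by (auto split: if_splits intro: inc_count_Suc_eq_0)
  qed
qed simp

lemma occ_count_Suc_eq_0: "occ_count j w = 0 \<Longrightarrow> occ_count (Suc j) w = 0"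
  by (induction j w rule: occ_count.induct) (auto split: if_splits intro: inc_count_Suc_eq_0)

text \<open>Dropping the last letter and dropping the letter for 3 give two different occurrences of
  the shorter pattern. Index 0 is excluded: the word 213 has one descent and contains 21-3.\<close>

lemma occ_count_Suc_eq_0_if_1:
  "occ_count (Suc j) w = 1 \<Longrightarrow> occ_count (Suc (Suc j)) w = 0"
proof (induction "Suc j" w rule: occ_count.induct)
  case (1 x y w)
  show ?case
  proof (cases "y < x \<and> inc_count (Suc j) x w \<noteq> 0")
    case True
    with 1 have "occ_count (Suc j) (y # w) = 0" "inc_count (Suc j) x w = 1" by auto
    with True show ?thesis
      using occ_count_Suc_eq_0 inc_count_Suc_eq_0_if_1 by simp
  next
    case False
    with 1 show ?thesis by (auto split: if_splits intro: inc_count_Suc_eq_0)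
  qed
qed auto

section \<open>Decomposition of 132-avoiding permutations at the maximum\<close>

definition Av :: "nat \<Rightarrow> nat list set" where
  "Av n = {w \<in> permutations_of_set {1..n}. no132 w}"

lemma Av_iff: "w \<in> Av n \<longleftrightarrow> set w = {1..n} \<and> distinct w \<and> no132 w"
  by (auto simp: Av_def permutations_of_set_def)

lemma length_Av: "w \<in> Av n \<Longrightarrow> length w = n"
  using distinct_card by (fastforce simp: Av_iff)

lemma finite_Av: "finite (Av n)"
  by (simp add: Av_def)

lemma Av_0: "Av 0 = {[]}"
  by (auto simp: Av_iff)

lemma join_in_Av:
  assumes "u \<in> Av a" "v \<in> Av b"
  shows "join u v \<in> Av (Suc (a + b))"
proof -
  have l: "length u = a" "length v = b" using assms by (auto simp: length_Av)
  have "(\<lambda>x. x + b) ` {1..a} = {Suc b..a + b}"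
    using image_add_atLeastAtMost'[of b 1 a] by (simp add: ac_simps)
  moreover have "no132 (join u v)"
    unfolding join_def using assms l
    by (subst no132_append_max) (auto simp: Av_iff no132_map_add)
  ultimately show ?thesis
    using assms l by (auto simp: Av_iff join_def distinct_map)
qed

lemma join_inject:
  assumes "join u v = join u' v'" "length u = length u'" "length v = length v'"
  shows "u = u' \<and> v = v'"
  using assms unfolding join_def
  by (auto dest: map_injective simp: inj_def)

lemma Av_Suc_cases:
  assumes "w \<in> Av (Suc n)"
  obtains u v a where "a \<le> n" "u \<in> Av a" "v \<in> Av (n - a)" "w = join u v"
proof -
  have w: "set w = {1..Suc n}" "distinct w" "no132 w" using assms by (auto simp: Av_iff)
  then have "Suc n \<in> set w" by auto
  then obtain u v where uv: "w = u @ Suc n # v" by (meson split_list)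
  define b where "b = length v"
  have un: "set u \<union> set v = {1..n}" and d: "set u \<inter> set v = {}" "distinct u" "distinct v"
  proof -
    have "set u \<union> set v = set w - {Suc n}" using w(2) unfolding uv by auto
    also have "\<dots> = {1..n}" unfolding w(1) by auto
    finally show "set u \<union> set v = {1..n}" .
  qed (use w(2) in \<open>simp_all add: uv\<close>)
  have lt: "y < x" if "x \<in> set u" "y \<in> set v" for x y
  proof -
    have "x \<le> n" "y \<le> n" using un that by auto
    with no132_append_max_le[of u "Suc n" v x y] w(3) uv that have "y \<le> x" by auto
    moreover have "x \<noteq> y" using d that by auto
    ultimately show ?thesis by simp
  qed
  have lv: "card (set v) = b" using d by (simp add: b_def distinct_card)
  \<comment> \<open>The letters of \<open>v\<close> lie below those of \<open>u\<close> and together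
    they exhaust \<open>{1..n}\<close>, so those of \<open>v\<close> form an initial
    segment.\<close>
  have v: "set v = {1..b}"
  proof (cases "set v = {}")
    case False
    define m where "m = Max (set v)"
    have m: "m \<in> set v" "\<And>y. y \<in> set v \<Longrightarrow> y \<le> m" using False by (auto simp: m_def)
    have "set v = {1..m}"
    proof
      show "set v \<subseteq> {1..m}" using m un by auto
      show "{1..m} \<subseteq> set v"
      proof
        fix y assume "y \<in> {1..m}"
        moreover have "m \<le> n" using m(1) un by auto
        ultimately have "y \<in> set u \<union> set v" "y \<le> m" using un by auto
        with lt[of y m] m show "y \<in> set v" by auto
      qed
    qed
    with lv show ?thesis by simp
  qed (use lv in auto)
  then have bn: "b \<le> n" using un by (cases "b = 0") auto
  have u: "set u = {Suc b..n}"
  proof -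
    have "set u = (set u \<union> set v) - set v" using d(1) by blast
    also have "\<dots> = {Suc b..n}" unfolding un unfolding v by auto
    finally show ?thesis .
  qed
  define u' where "u' = map (\<lambda>x. x - b) u"
  have u': "u = map (\<lambda>x. x + b) u'"
    unfolding u'_def map_map by (rule map_idI[symmetric]) (use u in auto)
  have lu: "length u = n - b" using distinct_card[OF d(2)] u by simp
  have "set u' = {1..n - b}"
  proof -
    have "(\<lambda>x. x + b) ` set u' = (\<lambda>x. x + b) ` {1..n - b}"
    proof -
      have "(\<lambda>x. x + b) ` set u' = {Suc b..n}" using u unfolding u' by simp
      also have "\<dots> = (\<lambda>x. x + b) ` {1..n - b}"
        using bn by (subst image_add_atLeastAtMost') simp
      finally show ?thesis .
    qed
    then show ?thesis by (subst (asm) inj_image_eq_iff) auto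
  qed
  moreover have "distinct u'" using d(2) unfolding u' distinct_map by simp
  moreover have "no132 u'" "no132 v"
  proof -
    have "\<forall>y\<in>set u \<union> set v. y < Suc n" unfolding un by auto
    then have "\<forall>y\<in>set u. y < Suc n" "\<forall>y\<in>set v. y < Suc n" by blast+
    moreover have "\<forall>x\<in>set u. \<forall>y\<in>set v. y \<le> x" using lt by (simp add: less_imp_le)
    ultimately have "no132 u \<and> no132 v"
      using no132_append_max[of u "Suc n" v] w(3) unfolding uv by simp
    then show "no132 u'" "no132 v" unfolding u' no132_map_add by simp_all
  qed
  ultimately have "u' \<in> Av (n - b)" "v \<in> Av (n - (n - b))"
    using v d(3) bn by (simp_all only: Av_iff diff_diff_cancel)
  moreover have "w = join u' v"
    using lu bn unfolding join_def uv u' b_def[symmetric] by simp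
  ultimately show ?thesis using that[of "n - b"] by simp
qed

lemma occ_count_0_join:
  assumes "u \<in> Av a" "v \<in> Av b"
  shows "occ_count 0 (join u v) = occ_count 0 u + occ_count 0 v + (if v = [] then 0 else 1)"
proof -
  have l: "length u = a" "length v = b" using assms by (auto simp: length_Av)
  show ?thesis unfolding join_def using assms l
    by (subst occ_count_0_append_max) (auto simp: Av_iff occ_count_map_add)
qed

lemma occ_count_Suc_join:
  assumes "u \<in> Av a" "v \<in> Av b"
  shows "occ_count (Suc j) (join u v) = occ_count (Suc j) u + occ_count j u + occ_count (Suc j) v"
proof -
  have l: "length u = a" "length v = b" using assms by (auto simp: length_Av)
  show ?thesis unfolding join_def using assms l
    by (subst occ_count_Suc_append_max) (auto simp: Av_iff occ_count_map_add)
qed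

section \<open>Generating functions and the product rule\<close>

definition av_gf :: "(nat list \<Rightarrow> bool) \<Rightarrow> real fps" where
  "av_gf P = Abs_fps (\<lambda>n. of_nat (card {w \<in> Av n. P w}))"

lemma card_Av_Suc:
  "card {w \<in> Av (Suc n). P w}
    = (\<Sum>a\<le>n. card {(u, v). u \<in> Av a \<and> v \<in> Av (n - a) \<and> P (join u v)})"
proof -
  define S where "S a = {(u, v). u \<in> Av a \<and> v \<in> Av (n - a) \<and> P (join u v)}" for a
  have fin: "finite (S a)" for a
    by (rule finite_subset[of _ "Av a \<times> Av (n - a)"]) (auto simp: S_def finite_Av)
  have "inj_on (case_prod join) (\<Union>a\<le>n. S a)"
  proof (rule inj_onI, clarify)
    fix a a' u v u' v'
    assume *: "a \<le> n" "a' \<le> n" "(u, v) \<in> S a" "(u', v') \<in> S a'" and j: "join u v = join u' v'"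
    then have l: "length u = a" "length v = n - a" "length u' = a'" "length v' = n - a'"
      by (auto simp: S_def length_Av)
    have max: "\<forall>x\<in>set (map (\<lambda>x. x + length v) u). x < Suc n" 
      "\<forall>x\<in>set (map (\<lambda>x. x + length v') u'). x < Suc n"
      using * l by (auto simp: S_def Av_iff)
    \<comment> \<open>The position of the maximum \<open>Suc n\<close> determines the left part, so
      different values of \<open>a\<close> give different words.\<close>
    have "takeWhile (\<lambda>x. x < Suc n) (join u v) = map (\<lambda>x. x + length v) u"
      "takeWhile (\<lambda>x. x < Suc n) (join u' v') = map (\<lambda>x. x + length v') u'"
      unfolding join_def using max * l
      by (subst takeWhile_append2; force)+
    with j have "map (\<lambda>x. x + length v) u = map (\<lambda>x. x + length v') u'" by simp
    then have "length u = length u'" by (metis length_map)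
    with j l show "u = u' \<and> v = v'" by (intro join_inject) auto
  qed
  moreover have "case_prod join ` (\<Union>a\<le>n. S a) = {w \<in> Av (Suc n). P w}" (is "?L = ?R")
  proof
    show "?L \<subseteq> ?R" using join_in_Av by (fastforce simp: S_def)
    show "?R \<subseteq> ?L"
    proof clarify
      fix w assume w: "w \<in> Av (Suc n)" "P w"
      from w(1) obtain u v a where "a \<le> n" "u \<in> Av a" "v \<in> Av (n - a)" "w = join u v"
        by (rule Av_Suc_cases)
      with w(2) have "(u, v) \<in> (\<Union>a\<le>n. S a)" "w = case_prod join (u, v)"
        by (auto simp: S_def)
      then show "w \<in> ?L" by blast
    qed
  qed
  ultimately have "card {w \<in> Av (Suc n). P w} = card (\<Union>a\<le>n. S a)"
    by (metis card_image)
  also have "\<dots> = (\<Sum>a\<le>n. card (S a))"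
  proof (rule card_UN_disjoint)
    show "\<forall>i\<in>{..n}. \<forall>j\<in>{..n}. i \<noteq> j \<longrightarrow> S i \<inter> S j = {}"
      by (auto simp: S_def dest!: length_Av)
  qed (use fin in auto)
  finally show ?thesis by (simp add: S_def)
qed

text \<open>\<open>join\<close> turns two exclusive product conditions into a sum of two products of
  series, and the empty word gives the constant term. A single product is obtained by taking
  \<open>Q'\<close> and \<open>R'\<close> false.\<close>

lemma av_gf_decompose:
  assumes "\<And>u v a b. u \<in> Av a \<Longrightarrow> v \<in> Av b \<Longrightarrow>
      P (join u v) \<longleftrightarrow> Q u \<and> R v \<or> Q' u \<and> R' v"
    and disj: "\<And>u v. Q u \<Longrightarrow> R v \<Longrightarrow> Q' u \<Longrightarrow> R' v \<Longrightarrow> False"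
  shows "av_gf P = (if P [] then 1 else 0) + fps_X * (av_gf Q * av_gf R + av_gf Q' * av_gf R')"
proof (rule fps_ext)
  fix n
  show "fps_nth (av_gf P) n = fps_nth ((if P [] then 1 else 0)
      + fps_X * (av_gf Q * av_gf R + av_gf Q' * av_gf R')) n"
  proof (cases n)
    case 0
    have "{w \<in> {[]}. P w} = (if P [] then {[]} else {})" by auto
    then show ?thesis using 0 by (simp add: av_gf_def Av_0)
  next
    case (Suc m)
    have "card {(u, v). u \<in> Av a \<and> v \<in> Av (m - a) \<and> P (join u v)}
      = card {w \<in> Av a. Q w} * card {w \<in> Av (m - a). R w}
        + card {w \<in> Av a. Q' w} * card {w \<in> Av (m - a). R' w}" for a
    proof -
      have "{(u, v). u \<in> Av a \<and> v \<in> Av (m - a) \<and> P (join u v)}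
        = {w \<in> Av a. Q w} \<times> {w \<in> Av (m - a). R w}
          \<union> {w \<in> Av a. Q' w} \<times> {w \<in> Av (m - a). R' w}"
        using assms(1) by blast
      also have "card \<dots> = card ({w \<in> Av a. Q w} \<times> {w \<in> Av (m - a). R w})
          + card ({w \<in> Av a. Q' w} \<times> {w \<in> Av (m - a). R' w})"
        by (rule card_Un_disjoint) (auto simp: finite_Av dest: disj)
      finally show ?thesis by (simp only: card_cartesian_product)
    qed
    then show ?thesis
      unfolding Suc
      by (simp add: av_gf_def card_Av_Suc fps_mult_nth[of "Abs_fps _"] sum.distrib atMost_atLeast0)
  qed
qed


section \<open>Agreement of the recursive counts with occurrences\<close>

definition inc_occs :: "nat \<Rightarrow> nat \<Rightarrow> nat list \<Rightarrow> nat list set" where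
  "inc_occs j x w = {is. length is = j \<and> sorted_wrt (<) is \<and> set is \<subseteq> {..<length w} \<and>
     sorted_wrt (<) (x # map (\<lambda>i. w ! i) is)}"

lemma inj_on_map_Suc: "inj_on (map Suc) S"
  by (simp add: inj_on_def)

lemma sorted_wrt_less_map_Suc: "sorted_wrt (<) (map Suc js) \<longleftrightarrow> sorted_wrt (<) js"
  by (simp add: sorted_wrt_map)

lemma map_Suc_pred: "0 \<notin> set js \<Longrightarrow> map Suc (map (\<lambda>i. i - 1) js) = js"
  by (auto simp: o_def intro!: map_idI Suc_pred gr0I)

text \<open>Position 0 is either omitted or comes first; on index lists this mirrors the recursion
  on words.\<close>

lemma sorted_wrt_less_Suc_cases:
  assumes "sorted_wrt (<) js"
  obtains js' where "js = map Suc js'" | js' where "js = 0 # map Suc js'"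
proof (cases "0 \<in> set js")
  case True
  then obtain i js' where js: "js = i # js'" by (cases js) auto
  with assms True have "i = 0" "0 \<notin> set js'" by force+
  with js that(2) map_Suc_pred show ?thesis by metis
next
  case False
  with that(1) map_Suc_pred show ?thesis by metis
qed

lemma map_Suc_in_inc_occs_Cons:
  "map Suc js \<in> inc_occs j x (y # w) \<longleftrightarrow> js \<in> inc_occs j x w"
  by (auto simp: inc_occs_def sorted_wrt_less_map_Suc o_def)

lemma Cons_map_Suc_in_inc_occs_Cons:
  "0 # map Suc js \<in> inc_occs j x (y # w) \<longleftrightarrow> (\<exists>i. j = Suc i \<and> x < y \<and> js \<in> inc_occs i y w)"
  by (auto simp: inc_occs_def sorted_wrt_less_map_Suc o_def)

lemma inc_occs_Cons:
  "inc_occs (Suc j) x (y # w) = map Suc ` inc_occs (Suc j) x w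
    \<union> (if x < y then (\<lambda>js. 0 # map Suc js) ` inc_occs j y w else {})" (is "?L = ?R")
proof
  show "?R \<subseteq> ?L"
    by (auto simp: map_Suc_in_inc_occs_Cons Cons_map_Suc_in_inc_occs_Cons split: if_splits)
  show "?L \<subseteq> ?R"
  proof
    fix js assume js: "js \<in> ?L"
    then have "sorted_wrt (<) js" by (simp add: inc_occs_def)
    then show "js \<in> ?R"
    proof (cases rule: sorted_wrt_less_Suc_cases)
      case (1 js')
      with js show ?thesis by (simp add: map_Suc_in_inc_occs_Cons)
    next
      case (2 js')
      with js show ?thesis by (auto simp: Cons_map_Suc_in_inc_occs_Cons)
    qed
  qed
qed

lemma finite_inc_occs: "finite (inc_occs j x w)"
  by (rule finite_subset[OF _ finite_lists_length_eq[of "{..<length w}" j]])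
    (auto simp: inc_occs_def)

lemma card_inc_occs: "card (inc_occs j x w) = inc_count j x w"
proof (induction j x w rule: inc_count.induct)
  case (1 x w)
  have "inc_occs 0 x w = {[]}" by (auto simp: inc_occs_def)
  then show ?case by simp
next
  case (2 j x)
  have "inc_occs (Suc j) x [] = {}" by (auto simp: inc_occs_def)
  then show ?case by simp
next
  case (3 j x y w)
  have "card (map Suc ` inc_occs (Suc j) x w) = card (inc_occs (Suc j) x w)"
    by (intro card_image inj_on_map_Suc)
  moreover have "card ((\<lambda>js. 0 # map Suc js) ` inc_occs j y w) = card (inc_occs j y w)"
    by (intro card_image) (simp add: inj_on_def)
  moreover have "map Suc ` inc_occs (Suc j) x w \<inter> (\<lambda>js. 0 # map Suc js) ` inc_occs j y w = {}"
    by auto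
  ultimately show ?case
    using 3 by (auto simp: inc_occs_Cons card_Un_disjoint finite_inc_occs)
qed

text \<open>The later letters exceed the 2 and therefore the 1 as well. This is why
  \<open>occ_count\<close> compares them with the first letter of the descent only.\<close>

lemma order_isomorphic_21_iff:
  "order_isomorphic xs (2 # 1 # [3..<j + 3]) \<longleftrightarrow>
    (\<exists>a b zs. xs = a # b # zs \<and> length zs = j \<and> b < a \<and> sorted_wrt (<) (a # zs))"
  (is "?L \<longleftrightarrow> ?R")
proof
  assume L: ?L
  then have "length xs = Suc (Suc j)" by (simp add: order_isomorphic_def)
  then obtain a b zs where xs: "xs = a # b # zs" "length zs = j"
    by (auto simp: length_Suc_conv)
  have iso: "xs ! p < xs ! q \<longleftrightarrow> (2 # 1 # [3..<j + 3]) ! p < (2 # 1 # [3..<j + 3]) ! q"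
    if "p < j + 2" "q < j + 2" for p q
    using L that xs by (simp add: order_isomorphic_def)
  have "b < a" using iso[of 1 0] by (simp add: xs(1))
  moreover have "a < z" if z: "z \<in> set zs" for z
  proof -
    obtain p where "p < length zs" "z = zs ! p" using z by (auto simp: in_set_conv_nth)
    then show ?thesis using iso[of 0 "Suc (Suc p)"] by (simp add: xs(1) flip: xs(2))
  qed
  moreover have "sorted_wrt (<) zs"
    unfolding sorted_wrt_iff_nth_less
  proof (intro allI impI)
    fix p q assume "p < q" "q < length zs"
    then show "zs ! p < zs ! q"
      using iso[of "Suc (Suc p)" "Suc (Suc q)"] by (simp add: xs(1) flip: xs(2))
  qed
  ultimately show ?R using xs by simp
next
  assume ?R
  then obtain a b zs where xs: "xs = a # b # zs" "length zs = j" "b < a" "\<forall>z\<in>set zs. a < z"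
    "sorted_wrt (<) zs" by auto
  define \<tau> where "\<tau> = 2 # 1 # [3..<j + 3]"
  have idx: "p = 0 \<or> p = 1 \<or> (\<exists>i<j. p = i + 2)" if "p < j + 2" for p
    using that by presburger
  have \<tau>: "\<tau> ! 0 = 2" "\<tau> ! 1 = 1" "\<And>i. i < j \<Longrightarrow> \<tau> ! (i + 2) = i + 3"
    by (simp_all add: \<tau>_def del: upt_Suc)
  have xs_nth: "xs ! 0 = a" "xs ! 1 = b" "\<And>i. xs ! (i + 2) = zs ! i"
    by (simp_all add: xs)
  have above: "a < zs ! i" "b < zs ! i" if "i < j" for i
    using xs(2-4) that nth_mem[of i zs] by (auto intro: less_trans)
  have mono: "xs ! p < xs ! q" if "p < j + 2" "q < j + 2" "\<tau> ! p < \<tau> ! q" for p q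
    using idx[OF that(1)] idx[OF that(2)]
  proof (elim disjE exE conjE)
    fix i l assume *: "i < j" "p = i + 2" "l < j" "q = l + 2"
    with that(3) have "i < l" by (simp only: \<tau>)
    with * xs(2,5) show ?thesis by (simp only: xs_nth sorted_wrt_iff_nth_less)
  qed (use that(3) above xs(3) \<tau> xs_nth in auto)
  have "distinct \<tau>" "length \<tau> = j + 2" by (auto simp: \<tau>_def)
  \<comment> \<open>One direction suffices: at distinct positions the letters of
    \<open>\<tau>\<close> differ, so one of the two orders holds and, by \<open>mono\<close>,
    excludes the other in \<open>xs\<close>.\<close>
  then have "xs ! p < xs ! q \<longleftrightarrow> \<tau> ! p < \<tau> ! q" if "p < j + 2" "q < j + 2" for p q
    using mono[OF that] mono[OF that(2,1)] that
    by (metis less_asym linorder_neqE_nat nth_eq_iff_index_eq)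
  then show ?L
    unfolding order_isomorphic_def \<tau>_def[symmetric] using xs(1,2) \<open>length \<tau> = j + 2\<close> by simp
qed

lemma occurrences_pattern_iff:
  "is \<in> occurrences (pattern_21_3_to (Suc (Suc j))) w \<longleftrightarrow>
    (\<exists>i js. is = i # Suc i # js \<and> length js = j \<and> sorted_wrt (<) is \<and>
      set is \<subseteq> {..<length w} \<and> w ! Suc i < w ! i \<and> sorted_wrt (<) (w ! i # map (\<lambda>i. w ! i) js))"
proof -
  have \<tau>: "letters (pattern_21_3_to (Suc (Suc j))) = 2 # 1 # [3..<j + 3]"
    "dashes (pattern_21_3_to (Suc (Suc j))) = {1..<j + 1}"
    by (simp_all add: pattern_21_3_to_def numeral_eq_Suc del: upt_Suc)
  \<comment> \<open>Only the first two letters lack a dash between them, hence the shape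
    \<open>i # Suc i # js\<close>.\<close>
  have "Suc p < length (2 # 1 # [3..<j + 3]) \<and> p \<notin> {1..<j + 1} \<longleftrightarrow> p = 0" for p
    by auto
  then show ?thesis
    unfolding occurrences_def \<tau> order_isomorphic_21_iff
    by (auto simp: map_eq_Cons_conv simp del: upt_Suc)
qed

lemma map_Suc_in_occurrences_Cons:
  "map Suc is \<in> occurrences (pattern_21_3_to (Suc (Suc j))) (x # w)
    \<longleftrightarrow> is \<in> occurrences (pattern_21_3_to (Suc (Suc j))) w"
proof -
  have "Suc ` S \<subseteq> {..<Suc n} \<longleftrightarrow> S \<subseteq> {..<n}" for S n by auto
  then show ?thesis
    unfolding occurrences_pattern_iff
    by (auto simp: map_eq_Cons_conv Cons_eq_map_conv sorted_wrt_less_map_Suc o_def)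
qed

lemma Cons_map_Suc_in_occurrences_Cons:
  "0 # map Suc is \<in> occurrences (pattern_21_3_to (Suc (Suc j))) (x # y # w)
    \<longleftrightarrow> y < x \<and> (\<exists>js. is = 0 # map Suc js \<and> js \<in> inc_occs j x w)" (is "?L \<longleftrightarrow> ?R")
proof
  assume L: ?L
  then obtain js where js: "map Suc is = Suc 0 # js" "sorted_wrt (<) (Suc 0 # js)"
    unfolding occurrences_pattern_iff by auto
  then have "sorted_wrt (<) is" by (metis sorted_wrt_less_map_Suc)
  then obtain js' where "is = 0 # map Suc js'"
    by (rule sorted_wrt_less_Suc_cases) (use js in auto)
  with L show ?R
    unfolding occurrences_pattern_iff by (auto simp: inc_occs_def sorted_wrt_map)
next
  assume ?R
  then show ?L
    unfolding occurrences_pattern_iff by (auto simp: inc_occs_def sorted_wrt_less_map_Suc o_def)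
qed

text \<open>For want of a dash, an occurrence that uses position 0 also uses position 1; its other
  positions lie in \<open>w\<close> and appear shifted by two.\<close>

lemma occurrences_pattern_Cons_Cons:
  "occurrences (pattern_21_3_to (Suc (Suc j))) (x # y # w)
    = map Suc ` occurrences (pattern_21_3_to (Suc (Suc j))) (y # w)
    \<union> (if y < x then (\<lambda>js. 0 # map Suc (0 # map Suc js)) ` inc_occs j x w else {})"
  (is "?L = ?R")
proof
  show "?R \<subseteq> ?L"
    using map_Suc_in_occurrences_Cons Cons_map_Suc_in_occurrences_Cons
    by (auto simp del: list.map split: if_splits)
  show "?L \<subseteq> ?R"
  proof
    fix js assume js: "js \<in> ?L"
    then have "sorted_wrt (<) js" by (simp add: occurrences_def)
    then show "js \<in> ?R"
    proof (cases rule: sorted_wrt_less_Suc_cases)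
      case (1 js')
      with js show ?thesis by (simp add: map_Suc_in_occurrences_Cons)
    next
      case (2 js')
      with js show ?thesis by (auto simp: Cons_map_Suc_in_occurrences_Cons)
    qed
  qed
qed

lemma finite_occurrences: "finite (occurrences \<tau> w)"
  by (rule finite_subset[OF _ finite_lists_length_eq[of "{..<length w}" "length (letters \<tau>)"]])
    (auto simp: occurrences_def)

lemma card_occurrences_pattern:
  "card (occurrences (pattern_21_3_to (Suc (Suc j))) w) = occ_count j w"
proof (induction j w rule: occ_count.induct)
  case (1 j x y w)
  let ?f = "\<lambda>js. 0 # map Suc (0 # map Suc js)"
  let ?O = "occurrences (pattern_21_3_to (Suc (Suc j))) (y # w)"
  have "card (map Suc ` ?O) = card ?O"
    by (intro card_image inj_on_map_Suc)
  moreover have "card (?f ` inc_occs j x w) = card (inc_occs j x w)"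
    by (intro card_image) (simp add: inj_on_def)
  moreover have "map Suc ` ?O \<inter> ?f ` inc_occs j x w = {}"
    by auto
  ultimately show ?case
    using 1 unfolding occurrences_pattern_Cons_Cons
    by (auto simp: card_Un_disjoint finite_inc_occs finite_occurrences card_inc_occs
        simp del: list.map)
next
  case ("2_1" j)
  have "occurrences (pattern_21_3_to (Suc (Suc j))) [] = {}"
    by (auto simp: occurrences_pattern_iff)
  then show ?case by simp
next
  case ("2_2" j x)
  have "occurrences (pattern_21_3_to (Suc (Suc j))) [x] = {}"
    by (auto simp: occurrences_pattern_iff)
  then show ?case by simp
qed

section \<open>Agreement of the recursive predicate with avoidance of 1-3-2\<close>

lemma all_less_pair_Suc:
  "(\<forall>j l. j < l \<longrightarrow> l < Suc n \<longrightarrow> Q j l) \<longleftrightarrow>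
    (\<forall>l<n. Q 0 (Suc l)) \<and> (\<forall>j l. j < l \<longrightarrow> l < n \<longrightarrow> Q (Suc j) (Suc l))" (is "?L \<longleftrightarrow> ?R")
proof
  assume R: ?R
  show ?L
  proof (intro allI impI)
    fix j l assume "j < l" "l < Suc n"
    with R show "Q j l" by (cases l; cases j) auto
  qed
qed auto

lemma all_less_triple_Suc:
  "(\<forall>i j l. i < j \<longrightarrow> j < l \<longrightarrow> l < Suc n \<longrightarrow> Q i j l) \<longleftrightarrow>
    (\<forall>j l. j < l \<longrightarrow> l < n \<longrightarrow> Q 0 (Suc j) (Suc l)) \<and>
    (\<forall>i j l. i < j \<longrightarrow> j < l \<longrightarrow> l < n \<longrightarrow> Q (Suc i) (Suc j) (Suc l))" (is "?L \<longleftrightarrow> ?R")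
proof
  assume R: ?R
  show ?L
  proof (intro allI impI)
    fix i j l assume "i < j" "j < l" "l < Suc n"
    with R show "Q i j l" by (cases l; cases j; cases i) auto
  qed
qed auto

lemma sorted_filter_iff_nth:
  "sorted (filter P w) \<longleftrightarrow>
    (\<forall>j l. j < l \<longrightarrow> l < length w \<longrightarrow> P (w ! j) \<and> P (w ! l) \<longrightarrow> w ! j \<le> w ! l)"
proof (induction w)
  case (Cons x w)
  have "(\<forall>y\<in>set (filter P w). x \<le> y) \<longleftrightarrow> (\<forall>l<length w. P (w ! l) \<longrightarrow> x \<le> w ! l)"
    by (auto simp: in_set_conv_nth)
  then show ?case
    by (simp only: length_Cons all_less_pair_Suc nth_Cons_0 nth_Cons_Suc Cons.IH[symmetric]) auto
qed simp

text \<open>With \<open>x\<close> as the 1, a violation is an inversion among the later letters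
  above \<open>x\<close>; the bound on the letter for 3 follows from that for 2.\<close>

lemma no132_iff_nth:
  "no132 w \<longleftrightarrow>
    (\<forall>i j l. i < j \<longrightarrow> j < l \<longrightarrow> l < length w \<longrightarrow> \<not> (w ! i < w ! l \<and> w ! l < w ! j))"
proof (induction w)
  case (Cons x w)
  have "sorted (filter (\<lambda>y. x < y) w) \<longleftrightarrow>
      (\<forall>j l. j < l \<longrightarrow> l < length w \<longrightarrow> \<not> (x < w ! l \<and> w ! l < w ! j))"
    unfolding sorted_filter_iff_nth by (meson less_trans not_less)
  then show ?case
    by (simp only: length_Cons all_less_triple_Suc nth_Cons_0 nth_Cons_Suc Cons.IH[symmetric]
        no132.simps)
qed simp

lemma occurrences_1_3_2_iff:
  "is \<in> occurrences pattern_1_3_2 w \<longleftrightarrow> (\<exists>i j l. is = [i, j, l] \<and> i < j \<and> j < l \<and> l < length w \<and>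
      w ! i < w ! l \<and> w ! l < w ! j)"
proof (cases "length is = 3")
  case True
  then obtain i j l where "is = [i, j, l]" by (auto simp: numeral_3_eq_3 length_Suc_conv)
  then show ?thesis
    by (auto simp: occurrences_def pattern_1_3_2_def order_isomorphic_def All_less_Suc
        numeral_3_eq_3 less_Suc_eq)
next
  case False
  then show ?thesis by (auto simp: occurrences_def pattern_1_3_2_def)
qed

lemma avoids_1_3_2_iff: "avoids w pattern_1_3_2 \<longleftrightarrow> no132 w"
proof -
  have "avoids w pattern_1_3_2 \<longleftrightarrow> (\<forall>is. is \<notin> occurrences pattern_1_3_2 w)"
    by (auto simp: avoids_def)
  also have "\<dots> \<longleftrightarrow> no132 w"
    unfolding occurrences_1_3_2_iff no132_iff_nth by blast
  finally show ?thesis .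
qed

section \<open>Functional equations\<close>

definition avoid_gf :: "nat \<Rightarrow> real fps" where
  "avoid_gf j = av_gf (\<lambda>w. occ_count j w = 0)"

definition once_gf :: "nat \<Rightarrow> real fps" where
  "once_gf j = av_gf (\<lambda>w. occ_count j w = 1)"

text \<open>The series written H in the outline. It describes a left part whose single occurrence is
  completed by the maximum and which contains no completed occurrence of its own.\<close>

definition once_tight_gf :: "nat \<Rightarrow> real fps" where
  "once_tight_gf j =
    av_gf (\<lambda>w. occ_count j w = 1 \<and> occ_count (Suc j) w = 0)"

lemma G_series_eq: "G_series (pattern_21_3_to (Suc (Suc j))) = once_gf j"
proof -
  have "{w \<in> permutations_of_set {1..n}. avoids w pattern_1_3_2 \<and>
      card (occurrences (pattern_21_3_to (Suc (Suc j))) w) = 1} = {w \<in> Av n. occ_count j w = 1}" for n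
    unfolding card_occurrences_pattern avoids_1_3_2_iff by (auto simp: Av_def)
  then show ?thesis by (simp add: G_series_def once_gf_def av_gf_def g_count_def)
qed

lemma av_gf_cong: "(\<And>w. P w \<longleftrightarrow> Q w) \<Longrightarrow> av_gf P = av_gf Q"
  by presburger

lemma once_tight_gf_Suc: "once_tight_gf (Suc j) = once_gf (Suc j)"
  unfolding once_tight_gf_def once_gf_def
  using occ_count_Suc_eq_0_if_1 by (intro av_gf_cong) blast

lemma av_gf_False: "av_gf (\<lambda>w. False) = 0"
  by (simp add: av_gf_def fps_eq_iff)

lemma av_gf_Nil: "av_gf (\<lambda>w. w = []) = 1"
  using av_gf_decompose[of "\<lambda>w. w = []" "\<lambda>w. False" "\<lambda>w. False" "\<lambda>w. False" "\<lambda>w. False"]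
  by (simp add: join_def av_gf_False)

text \<open>A nonempty right part creates a descent, so the right factor is the series 1 of the
  empty word.\<close>

lemma avoid_gf_0: "avoid_gf 0 = 1 + fps_X * avoid_gf 0"
proof -
  have "av_gf (\<lambda>w. occ_count 0 w = 0)
      = 1 + fps_X * (avoid_gf 0 * av_gf (\<lambda>w. w = []) + av_gf (\<lambda>w. False) * av_gf (\<lambda>w. False))"
    unfolding avoid_gf_def by (subst av_gf_decompose) (auto simp: occ_count_0_join)
  then show ?thesis by (simp add: avoid_gf_def av_gf_False av_gf_Nil)
qed

text \<open>Avoiding the shorter pattern in \<open>u\<close> already implies avoiding the longer one
  there.\<close>

lemma avoid_gf_Suc: "avoid_gf (Suc j) = 1 + fps_X * avoid_gf j * avoid_gf (Suc j)"
proof -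
  have "av_gf (\<lambda>w. occ_count (Suc j) w = 0)
      = 1 + fps_X * (avoid_gf j * avoid_gf (Suc j) + av_gf (\<lambda>w. False) * av_gf (\<lambda>w. False))"
    unfolding avoid_gf_def
    by (subst av_gf_decompose) (auto simp: occ_count_Suc_join intro: occ_count_Suc_eq_0)
  then show ?thesis by (simp add: avoid_gf_def av_gf_False mult.assoc)
qed

text \<open>The single occurrence lies in \<open>v\<close> or is completed by the maximum. It cannot
  lie in \<open>u\<close>, because replacing its last letter by the maximum would give a second
  one.\<close>

lemma once_gf_Suc:
  "once_gf (Suc j) = fps_X * (avoid_gf j * once_gf (Suc j) + once_tight_gf j * avoid_gf (Suc j))"
proof -
  have "occ_count (Suc j) (join u v) = 1 \<longleftrightarrow>
      occ_count j u = 0 \<and> occ_count (Suc j) v = 1 \<or>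
      (occ_count j u = 1 \<and> occ_count (Suc j) u = 0) \<and> occ_count (Suc j) v = 0"
    if "u \<in> Av a" "v \<in> Av b" for u v a b
    using occ_count_Suc_eq_0[of j u] unfolding occ_count_Suc_join[OF that] by arith
  then have "av_gf (\<lambda>w. occ_count (Suc j) w = 1) = (if occ_count (Suc j) [] = 1 then 1 else 0)
      + fps_X * (avoid_gf j * once_gf (Suc j) + once_tight_gf j * avoid_gf (Suc j))"
    unfolding avoid_gf_def once_gf_def once_tight_gf_def by (rule av_gf_decompose) simp_all
  then show ?thesis by (simp add: once_gf_def)
qed

text \<open>A descent inside \<open>u\<close> would form 21-3 with the maximum. Hence
  \<open>v\<close> is nonempty and the single descent is the one leaving the maximum;
  \<open>u\<close> and \<open>v\<close> are increasing.\<close>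

lemma once_tight_gf_0: "once_tight_gf 0 = fps_X\<^sup>2 * (avoid_gf 0)\<^sup>2"
proof -
  have "av_gf (\<lambda>w. occ_count 0 w = 0 \<and> w \<noteq> [])
      = 0 + fps_X * (avoid_gf 0 * av_gf (\<lambda>w. w = []) + av_gf (\<lambda>w. False) * av_gf (\<lambda>w. False))"
    unfolding avoid_gf_def by (subst av_gf_decompose) (auto simp: occ_count_0_join join_def[of _ "[]"])
  then have *: "av_gf (\<lambda>w. occ_count 0 w = 0 \<and> w \<noteq> []) = fps_X * avoid_gf 0"
    by (simp add: av_gf_False av_gf_Nil)
  have "occ_count 0 (join u v) = 1 \<and> occ_count (Suc 0) (join u v) = 0 \<longleftrightarrow>
      occ_count 0 u = 0 \<and> (occ_count 0 v = 0 \<and> v \<noteq> []) \<or> False \<and> False"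
    if "u \<in> Av a" "v \<in> Av b" for u v a b
    using occ_count_Suc_eq_0[of 0 u] occ_count_Suc_eq_0[of 0 v]
    unfolding occ_count_0_join[OF that] occ_count_Suc_join[OF that] by auto
  then have "once_tight_gf 0 = (if occ_count 0 [] = 1 \<and> occ_count (Suc 0) [] = 0 then 1 else 0)
      + fps_X * (avoid_gf 0 * av_gf (\<lambda>w. occ_count 0 w = 0 \<and> w \<noteq> [])
        + av_gf (\<lambda>w. False) * av_gf (\<lambda>w. False))"
    unfolding avoid_gf_def once_tight_gf_def by (rule av_gf_decompose) simp_all
  then show ?thesis unfolding * by (simp add: av_gf_False power2_eq_square ac_simps)
qed

section \<open>Recurrence for the Chebyshev polynomials at 1/(2t)\<close>

lemma Chebyshev_U_0: "Chebyshev_U 0 = 1"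
  unfolding Chebyshev_U_def by (rule the1_equality[OF Chebyshev_U_unique[of 0]]) auto

lemma Chebyshev_U_1: "Chebyshev_U 1 = [:0, 2:]"
  unfolding Chebyshev_U_def
  by (rule the1_equality[OF Chebyshev_U_unique[of 1]]) (auto simp: sin_double)

lemma Chebyshev_U_Suc_Suc:
  "Chebyshev_U (Suc (Suc p)) = pCons 0 (smult 2 (Chebyshev_U (Suc p))) - Chebyshev_U p"
  unfolding Chebyshev_U_def[of "Suc (Suc p)"]
proof (rule the1_equality[OF Chebyshev_U_unique[of "Suc (Suc p)"]], intro allI impI)
  fix \<theta> :: real assume s: "sin \<theta> \<noteq> 0"
  define a where "a = (real (Suc p) + 1) * \<theta>"
  have e: "(real (Suc (Suc p)) + 1) * \<theta> = a + \<theta>" "(real p + 1) * \<theta> = a - \<theta>"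
    by (simp_all add: a_def algebra_simps)
  have "sin (a + \<theta>) = 2 * cos \<theta> * sin a - sin (a - \<theta>)" by (simp add: sin_add sin_diff)
  then show "poly (pCons 0 (smult 2 (Chebyshev_U (Suc p))) - Chebyshev_U p) (cos \<theta>)
      = sin ((real (Suc (Suc p)) + 1) * \<theta>) / sin \<theta>"
    unfolding e
    using Chebyshev_U_cos[OF s, of p] Chebyshev_U_cos[OF s, of "Suc p"] s
    unfolding e a_def[symmetric] by (simp add: field_simps)
qed

lemma Chebyshev_U_half_inv_0: "Chebyshev_U_half_inv 0 = 1"
  by (simp add: Chebyshev_U_half_inv_def Chebyshev_U_0)

lemma map_poly_fls_const_diff:
  "map_poly fls_const (p - q) = map_poly fls_const p - map_poly fls_const (q :: real poly)"
  by (rule poly_eqI) (simp add: coeff_map_poly flip: fls_minus_const)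

lemma map_poly_fls_const_smult:
  "map_poly fls_const (smult c p) = smult (fls_const c) (map_poly fls_const (p :: real poly))"
  by (rule poly_eqI) (simp add: coeff_map_poly)

lemma half_inv_fls_X: "fls_X * (2 * (1 / (2 * fls_X))) = (1 :: real fls)"
proof -
  have "fls_X * (2 * (1 / (2 * fls_X))) = (2 * fls_X) / (2 * fls_X :: real fls)"
    unfolding times_divide_eq_right by (simp only: mult_1_left mult_1_right mult.commute)
  also have "\<dots> = 1" by (rule divide_self) simp
  finally show ?thesis .
qed

lemma fls_X_times_Chebyshev_U_half_inv_1: "fls_X * Chebyshev_U_half_inv (Suc 0) = 1"
proof -
  have "Chebyshev_U_half_inv (Suc 0) = 2 * (1 / (2 * fls_X))"
    unfolding Chebyshev_U_half_inv_def Chebyshev_U_1[unfolded One_nat_def]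
    by (simp only: map_poly_pCons map_poly_0 poly_pCons poly_0 fls_const_0) simp
  then show ?thesis by (simp only: half_inv_fls_X)
qed

text \<open>At 1/(2t) the factor 2x of the Chebyshev recurrence becomes 1/t; multiplying by t clears
  it.\<close>

lemma fls_X_times_Chebyshev_U_half_inv_Suc_Suc:
  "fls_X * Chebyshev_U_half_inv (Suc (Suc p))
    = Chebyshev_U_half_inv (Suc p) - fls_X * Chebyshev_U_half_inv p"
proof -
  define y :: "real fls" where "y = 1 / (2 * fls_X)"
  have y: "fls_X * (2 * y) = 1" unfolding y_def by (rule half_inv_fls_X)
  have "Chebyshev_U_half_inv (Suc (Suc p))
      = y * (2 * Chebyshev_U_half_inv (Suc p)) - Chebyshev_U_half_inv p"
    unfolding Chebyshev_U_half_inv_def Chebyshev_U_Suc_Suc map_poly_fls_const_diff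
      y_def[symmetric]
    by (simp add: map_poly_pCons map_poly_fls_const_smult)
  with y show ?thesis by algebra
qed

section \<open>Substitution of t^2 and solution of the equations\<close>

definition at_sq :: "real fps \<Rightarrow> real fls" where
  "at_sq F = fps_to_fls (F oo fps_X\<^sup>2)"

lemma at_sq_simps:
  "at_sq (F + F') = at_sq F + at_sq F'"
  "at_sq (F * F') = at_sq F * at_sq F'" "at_sq 1 = 1" "at_sq fps_X = fls_X\<^sup>2"
  by (simp_all add: at_sq_def fps_compose_add_distrib fps_compose_mult_distrib
      fls_times_fps_to_fls fps_to_fls_power)

lemma at_sq_avoid_gf:
  "fls_X * at_sq (avoid_gf j) * Chebyshev_U_half_inv (Suc (Suc j)) = Chebyshev_U_half_inv (Suc j)
    \<and> Chebyshev_U_half_inv (Suc j) \<noteq> 0"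
proof (induction j)
  case 0
  have "at_sq (avoid_gf 0) = 1 + fls_X\<^sup>2 * at_sq (avoid_gf 0)"
    by (subst avoid_gf_0) (simp add: at_sq_simps)
  moreover have "fls_X * Chebyshev_U_half_inv (Suc (Suc 0)) = Chebyshev_U_half_inv (Suc 0) - fls_X"
    using fls_X_times_Chebyshev_U_half_inv_Suc_Suc[of 0] by (simp add: Chebyshev_U_half_inv_0)
  moreover note fls_X_times_Chebyshev_U_half_inv_1
  ultimately have "fls_X * at_sq (avoid_gf 0) * Chebyshev_U_half_inv (Suc (Suc 0))
      = Chebyshev_U_half_inv (Suc 0)" by algebra
  with fls_X_times_Chebyshev_U_half_inv_1 show ?case by auto
next
  case (Suc j)
  have "at_sq (avoid_gf (Suc j)) = 1 + fls_X\<^sup>2 * at_sq (avoid_gf j) * at_sq (avoid_gf (Suc j))"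
    by (subst avoid_gf_Suc) (simp add: at_sq_simps)
  \<comment> \<open>Write a_j for the image of \<open>avoid_gf j\<close>. Multiplying a_(j+1) (1 -
    t^2 a_j) = 1 by U_(j+2) and using the induction hypothesis gives a_(j+1) (U_(j+2) - t U_(j+1)) =
    U_(j+2), and the bracket is t U_(j+3).\<close>
  with fls_X_times_Chebyshev_U_half_inv_Suc_Suc[of "Suc j"] conjunct1[OF Suc]
  have "fls_X * at_sq (avoid_gf (Suc j)) * Chebyshev_U_half_inv (Suc (Suc (Suc j)))
      = Chebyshev_U_half_inv (Suc (Suc j))" by algebra
  with Suc show ?case by auto
qed

lemma at_sq_once_tight_gf:
  "at_sq (once_tight_gf j) * (Chebyshev_U_half_inv (Suc (Suc j)))\<^sup>2 = 1"
proof (induction j)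
  case 0
  have "at_sq (once_tight_gf 0) = (fls_X\<^sup>2 * at_sq (avoid_gf 0))\<^sup>2"
    by (simp add: once_tight_gf_0 at_sq_simps power2_eq_square)
  \<comment> \<open>The inner product is U_1, and t U_1 = 1.\<close>
  then have "at_sq (once_tight_gf 0) * (Chebyshev_U_half_inv (Suc (Suc 0)))\<^sup>2
      = (fls_X * (fls_X * at_sq (avoid_gf 0) * Chebyshev_U_half_inv (Suc (Suc 0))))\<^sup>2"
    by (simp add: power2_eq_square ac_simps)
  then show ?case
    unfolding conjunct1[OF at_sq_avoid_gf[of 0]] fls_X_times_Chebyshev_U_half_inv_1 by simp
next
  case (Suc j)
  have "at_sq (avoid_gf (Suc j)) = 1 + fls_X\<^sup>2 * at_sq (avoid_gf j) * at_sq (avoid_gf (Suc j))"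
    by (subst avoid_gf_Suc) (simp add: at_sq_simps)
  moreover have "at_sq (once_tight_gf (Suc j))
      = fls_X\<^sup>2 * (at_sq (avoid_gf j) * at_sq (once_tight_gf (Suc j))
        + at_sq (once_tight_gf j) * at_sq (avoid_gf (Suc j)))"
    unfolding once_tight_gf_Suc by (subst once_gf_Suc) (simp add: at_sq_simps)
  \<comment> \<open>The second equation is linear in the unknown series with coefficient 1 - t^2
    a_j, whose inverse is a_(j+1) by the first.\<close>
  ultimately have "at_sq (once_tight_gf (Suc j))
      = fls_X\<^sup>2 * at_sq (once_tight_gf j) * (at_sq (avoid_gf (Suc j)))\<^sup>2"
    by algebra
  \<comment> \<open>By \<open>at_sq_avoid_gf\<close> the squared factor is that of U_(j+2), so the
    product equals the one for \<open>j\<close>.\<close>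
  then have "at_sq (once_tight_gf (Suc j)) * (Chebyshev_U_half_inv (Suc (Suc (Suc j))))\<^sup>2
      = at_sq (once_tight_gf j)
        * (fls_X * at_sq (avoid_gf (Suc j)) * Chebyshev_U_half_inv (Suc (Suc (Suc j))))\<^sup>2"
    by (simp add: power2_eq_square ac_simps)
  then show ?case unfolding conjunct1[OF at_sq_avoid_gf[of "Suc j"]] Suc .
qed

theorem theorem3p7:
  fixes k :: nat
  assumes "k \<ge> 3"
  shows "fps_to_fls (G_series (pattern_21_3_to k) oo fps_X\<^sup>2) = 1 / (Chebyshev_U_half_inv k)\<^sup>2"
proof -
  obtain j where k: "k = Suc (Suc (Suc j))"
    using assms by (auto simp: numeral_3_eq_3 dest!: le_Suc_ex)
  \<comment> \<open>The index \<open>k - 2 = Suc j\<close> is positive, so the tight series is the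
    series of exactly one occurrence.\<close>
  have *: "at_sq (once_gf (Suc j)) * (Chebyshev_U_half_inv k)\<^sup>2 = 1"
    using at_sq_once_tight_gf[of "Suc j"] unfolding k once_tight_gf_Suc .
  then have "(Chebyshev_U_half_inv k)\<^sup>2 \<noteq> 0" by (metis mult_zero_right zero_neq_one)
  then have "at_sq (once_gf (Suc j)) = 1 / (Chebyshev_U_half_inv k)\<^sup>2"
    using * by (rule iffD2[OF nonzero_eq_divide_eq])
  then show ?thesis unfolding k G_series_eq at_sq_def .
qed

end
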